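(* For every positive integer $n$, $$\mathsf{D}(\mathcal{C}_n) = \Theta(n\log n), \qquad \mathsf{R}(\mathcal{C}_n) = \Theta(n\log n), \qquad \mathsf{Q}(\mathcal{C}_n) = \Omega(n) \text{ and } \mathsf{Q}(\mathcal{C}_n) = O(n\log n).$$
   Context: Let $L_n$ be the $n\times n$ 0-1 matrix with $L_n(i,j)=1$ iff $i\ge j$ (ones on and below the main diagonal). $\mathcal{C}_n$ is the set of all matrices obtained from $L_n$ by an arbitrary permutation of its columns. These are bipartite adjacency matrices of "column-permuted half graphs". Learning a hidden matrix $M$ from a known family $\mathcal{X}_n$ of $n\times n$ 0-1 matrices: an edge query on $(i,j)\in[n]\times[n]$ returns $M(i,j)$, and the algorithm must output $M$. $\mathsf{D}(\mathcal{X}_n)$ is the minimum worst-case number of queries of a deterministic decision tree that always outputs $M$ correctly. $\mathsf{R}(\mathcal{X}_n)$ is the minimum worst-case number of queries of a randomized algorithm (a distribution over decision trees) that outputs $M$ with probability at least $2/3$ on every input. $\mathsf{Q}(\mathcal{X}_n)$ is the minimum number of queries of a quantum query algorithm that outputs $M$ with probability at least $2/3$ on every input. Its query oracle is $|(i,j)\rangle|b\rangle\mapsto|(i,j)\rangle|b\oplus M(i,j)\rangle$. Logarithms are base 2. *)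

theory Defs
  imports "HOL-Probability.Probability_Mass_Function" "HOL-Combinatorics.Permutations"
    "Jordan_Normal_Form.Matrix"
begin

text \<open>A 0-1 matrix is a \<^typ>\<open>bool mat\<close>, with \<^const>\<open>True\<close> for the entry 1. Rows and columns
  are indexed by \<open>0, \<dots>, n - 1\<close>, so \<open>[n]\<close> is \<open>{..<n}\<close>.\<close>

definition half_graph_mat :: "nat \<Rightarrow> bool mat" where
  "half_graph_mat n = mat n n (\<lambda>(i, j). i \<ge> j)"

definition col_permuted_half_graphs :: "nat \<Rightarrow> bool mat set" where
  "col_permuted_half_graphs n =
    {mat n n (\<lambda>(i, j). half_graph_mat n $$ (i, \<pi> j)) | \<pi>. \<pi> permutes {..<n}}"


section \<open>Decision trees\<close>

text \<open>\<open>Query i j t0 t1\<close> queries the entry \<open>(i, j)\<close> and continues with \<open>t0\<close> on answer 0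
  and with \<open>t1\<close> on answer 1.\<close>

datatype dtree = Output "bool mat" | Query nat nat dtree dtree

fun tree_output :: "dtree \<Rightarrow> bool mat \<Rightarrow> bool mat" where
  "tree_output (Output A) M = A"
| "tree_output (Query i j t0 t1) M = tree_output (if M $$ (i, j) then t1 else t0) M"

fun num_queries :: "dtree \<Rightarrow> bool mat \<Rightarrow> nat" where
  "num_queries (Output A) M = 0"
| "num_queries (Query i j t0 t1) M = Suc (num_queries (if M $$ (i, j) then t1 else t0) M)"

text \<open>Only positions inside \<open>[n] \<times> [n]\<close> may be queried.\<close>

fun queries_within :: "nat \<Rightarrow> dtree \<Rightarrow> bool" where
  "queries_within n (Output A) \<longleftrightarrow> True"
| "queries_within n (Query i j t0 t1) \<longleftrightarrow>
     i < n \<and> j < n \<and> queries_within n t0 \<and> queries_within n t1"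

definition det_learns :: "nat \<Rightarrow> bool mat set \<Rightarrow> nat \<Rightarrow> bool" where
  "det_learns n X T \<longleftrightarrow>
    (\<exists>t. queries_within n t \<and> (\<forall>M\<in>X. tree_output t M = M \<and> num_queries t M \<le> T))"

definition rand_learns :: "nat \<Rightarrow> bool mat set \<Rightarrow> nat \<Rightarrow> bool" where
  "rand_learns n X T \<longleftrightarrow>
    (\<exists>p :: dtree pmf.
       (\<forall>t\<in>set_pmf p. queries_within n t \<and> (\<forall>M\<in>X. num_queries t M \<le> T)) \<and>
       (\<forall>M\<in>X. measure_pmf.prob p {t. tree_output t M = M} \<ge> 2 / 3))"

definition D_query :: "nat \<Rightarrow> bool mat set \<Rightarrow> nat" where
  "D_query n X = (LEAST T. det_learns n X T)"

definition R_query :: "nat \<Rightarrow> bool mat set \<Rightarrow> nat" where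
  "R_query n X = (LEAST T. rand_learns n X T)"


section \<open>Quantum query algorithms\<close>

text \<open>Computational basis states are labelled \<open>(i, j, b, a)\<close>: query position, answer bit, and
  the content of a work register of arbitrary finite size \<open>w\<close>. States and operators on the Hilbert
  space with basis \<open>B\<close> are given by coordinates; values at labels outside \<open>B\<close> are irrelevant.\<close>

type_synonym label = "nat \<times> nat \<times> bool \<times> nat"

definition labels :: "nat \<Rightarrow> nat \<Rightarrow> label set" where
  "labels n w = {..<n} \<times> {..<n} \<times> UNIV \<times> {..<w}"

definition ket :: "label \<Rightarrow> label \<Rightarrow> complex" where
  "ket y = (\<lambda>x. of_bool (x = y))"

definition apply_op :: "label set \<Rightarrow> (label \<Rightarrow> label \<Rightarrow> complex) \<Rightarrow> (label \<Rightarrow> complex) \<Rightarrow> label \<Rightarrow> complex"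
  where "apply_op B U \<psi> = (\<lambda>x. \<Sum>y\<in>B. U x y * \<psi> y)"

text \<open>\<open>U\<^sup>* U = 1\<close>, which on a finite-dimensional space is unitarity.\<close>

definition unitary_op :: "label set \<Rightarrow> (label \<Rightarrow> label \<Rightarrow> complex) \<Rightarrow> bool" where
  "unitary_op B U \<longleftrightarrow> (\<forall>x\<in>B. \<forall>y\<in>B. (\<Sum>z\<in>B. cnj (U z x) * U z y) = of_bool (x = y))"

text \<open>\<open>|(i, j)\<rangle>|b\<rangle>|a\<rangle> \<mapsto> |(i, j)\<rangle>|b \<oplus> M(i, j)\<rangle>|a\<rangle>\<close>, exclusive or being \<open>\<noteq>\<close> on
  \<^typ>\<open>bool\<close>; column \<open>y\<close> of the matrix is the image of the basis state \<open>y\<close>.\<close>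

definition oracle_op :: "bool mat \<Rightarrow> label \<Rightarrow> label \<Rightarrow> complex" where
  "oracle_op M x y = (case y of (i, j, b, a) \<Rightarrow> ket (i, j, b \<noteq> M $$ (i, j), a) x)"

text \<open>The state \<open>U\<^sub>T O\<^sub>M U\<^sub>T\<^sub>-\<^sub>1 \<cdots> O\<^sub>M U\<^sub>0 |0\<rangle>\<close> after \<open>T\<close> queries.\<close>

fun run_quantum ::
  "label set \<Rightarrow> (nat \<Rightarrow> label \<Rightarrow> label \<Rightarrow> complex) \<Rightarrow> bool mat \<Rightarrow> nat \<Rightarrow> label \<Rightarrow> complex" where
  "run_quantum B U M 0 = apply_op B (U 0) (ket (0, 0, False, 0))"
| "run_quantum B U M (Suc T) =
     apply_op B (U (Suc T)) (apply_op B (oracle_op M) (run_quantum B U M T))"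

text \<open>The final state is measured in the computational basis and the outcome \<open>x\<close> is answered
  with \<open>out x\<close>.\<close>

definition output_prob :: "label set \<Rightarrow> (label \<Rightarrow> bool mat) \<Rightarrow> (label \<Rightarrow> complex) \<Rightarrow> bool mat \<Rightarrow> real"
  where "output_prob B out \<psi> A = (\<Sum>x | x \<in> B \<and> out x = A. (cmod (\<psi> x))\<^sup>2)"

definition quantum_learns :: "nat \<Rightarrow> bool mat set \<Rightarrow> nat \<Rightarrow> bool" where
  "quantum_learns n X T \<longleftrightarrow>
    (\<exists>w U out. w > 0 \<and>
       (\<forall>t\<le>T. unitary_op (labels n w) (U t)) \<and>
       (\<forall>M\<in>X. output_prob (labels n w) out (run_quantum (labels n w) U M T) M \<ge> 2 / 3))"

definition Q_query :: "nat \<Rightarrow> bool mat set \<Rightarrow> nat" where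
  "Q_query n X = (LEAST T. quantum_learns n X T)"

end

theory Submission
  imports Defs
begin

text \<open>The column \<open>j\<close> of the matrix of \<open>\<pi>\<close> is a threshold at row \<open>\<pi> j\<close>, so binary search in every
  column learns the matrix; a decision tree is a randomized algorithm, and also a quantum one that
  records the answers in its work register. Conversely a tree of depth \<open>T\<close> is right on at most
  \<open>2 ^ T\<close> of the \<open>n!\<close> inputs. For the quantum bound, compare \<open>\<pi>\<close> with the \<open>n - 1\<close> permutations that
  exchange the values \<open>s\<close> and \<open>s + 1\<close>: the two matrices differ only in two entries of row \<open>s\<close>.
  The squared distances between their states, summed over all \<open>\<pi>\<close> and \<open>s\<close>, grow by at most \<open>4 n!\<close>
  in each query, but must reach a constant fraction of \<open>(n - 1) n!\<close>.\<close>

section \<open>Matrices of column permutations\<close>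

definition perm_half_graph :: "nat \<Rightarrow> (nat \<Rightarrow> nat) \<Rightarrow> bool mat" where
  "perm_half_graph n \<pi> = mat n n (\<lambda>(i, j). half_graph_mat n $$ (i, \<pi> j))"

lemma col_permuted_half_graphs_eq:
  "col_permuted_half_graphs n = perm_half_graph n ` {\<pi>. \<pi> permutes {..<n}}"
  by (auto simp: col_permuted_half_graphs_def perm_half_graph_def)

lemma permutes_lessThan_less: "\<pi> permutes {..<n} \<Longrightarrow> j < n \<Longrightarrow> \<pi> j < (n::nat)"
  using permutes_in_image by fastforce

lemma perm_half_graph_index:
  assumes "\<pi> permutes {..<n}" "i < n" "j < n"
  shows "perm_half_graph n \<pi> $$ (i, j) \<longleftrightarrow> \<pi> j \<le> i"
  using assms permutes_lessThan_less[OF assms(1,3)]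
  by (simp add: perm_half_graph_def half_graph_mat_def)

text \<open>Column \<open>j\<close> shows its threshold: comparing the entries at rows
  \<open>\<pi> j\<close> and \<open>\<sigma> j\<close> forces the two values to agree, and both
  permutations fix everything from \<open>n\<close> on. Hence the family has exactly
  \<open>n!\<close> members.\<close>

lemma inj_on_perm_half_graph: "inj_on (perm_half_graph n) {\<pi>. \<pi> permutes {..<n}}"
proof (rule inj_onI, clarsimp)
  fix \<pi> \<sigma> assume p: "\<pi> permutes {..<n}" and s: "\<sigma> permutes {..<n}"
    and eq: "perm_half_graph n \<pi> = perm_half_graph n \<sigma>"
  show "\<pi> = \<sigma>"
  proof
    fix j
    show "\<pi> j = \<sigma> j"
    proof (cases "j < n")
      case True
      have le: "\<pi> j \<le> i \<longleftrightarrow> \<sigma> j \<le> i" if "i < n" for i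
        using perm_half_graph_index[OF p that True] perm_half_graph_index[OF s that True] eq by simp
      show ?thesis
        using le[of "\<pi> j"] le[of "\<sigma> j"] permutes_lessThan_less[OF p True]
          permutes_lessThan_less[OF s True] by simp
    next
      case False
      then show ?thesis using p s by (simp add: permutes_not_in)
    qed
  qed
qed

lemma finite_col_permuted_half_graphs: "finite (col_permuted_half_graphs n)"
  by (simp add: col_permuted_half_graphs_eq finite_permutations)

lemma card_col_permuted_half_graphs: "card (col_permuted_half_graphs n) = fact n"
  by (simp add: col_permuted_half_graphs_eq card_image inj_on_perm_half_graph card_permutations)


section \<open>Learning by binary search\<close>

text \<open>Determines the value \<open>\<pi> j\<close> known to lie in \<open>{lo..<lo + 2 ^ k}\<close> and continues with \<open>c (\<pi> j)\<close>;
  a row beyond the matrix needs no query.\<close>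

fun search_col :: "nat \<Rightarrow> nat \<Rightarrow> nat \<Rightarrow> nat \<Rightarrow> (nat \<Rightarrow> dtree) \<Rightarrow> dtree" where
  "search_col n j 0 lo c = c lo"
| "search_col n j (Suc k) lo c =
     (if n < lo + 2 ^ k then search_col n j k lo c
      else Query (lo + 2 ^ k - 1) j (search_col n j k (lo + 2 ^ k) c) (search_col n j k lo c))"

text \<open>Columns are searched from the last to the first, and \<open>f\<close> collects the
  values found. It need not be a permutation on the way, which is why \<open>perm_half_graph\<close>
  takes an arbitrary function.\<close>

fun search_cols :: "nat \<Rightarrow> nat \<Rightarrow> nat \<Rightarrow> (nat \<Rightarrow> nat) \<Rightarrow> dtree" where
  "search_cols n k 0 f = Output (perm_half_graph n f)"
| "search_cols n k (Suc j) f = search_col n j k 0 (\<lambda>v. search_cols n k j (f(j := v)))"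

lemma queries_within_search_col:
  assumes "j < n" "\<And>v. queries_within n (c v)"
  shows "queries_within n (search_col n j k lo c)"
proof (induction k arbitrary: lo)
  case (Suc k)
  have "0 < (2::nat) ^ k" by simp
  then have "lo + 2 ^ k - 1 < n" if "\<not> n < lo + 2 ^ k"
    using that by linarith
  with Suc show ?case using assms by simp
qed (use assms in simp)

lemma search_col_correct:
  assumes "\<pi> permutes {..<n}" "j < n" "lo \<le> \<pi> j" "\<pi> j < lo + 2 ^ k"
  defines "M \<equiv> perm_half_graph n \<pi>"
  shows "tree_output (search_col n j k lo c) M = tree_output (c (\<pi> j)) M \<and>
    num_queries (search_col n j k lo c) M \<le> k + num_queries (c (\<pi> j)) M"
  using assms(3,4)
proof (induction k arbitrary: lo)
  case 0
  then have "\<pi> j = lo" by simp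
  then show ?case by simp
next
  case (Suc k)
  have pos: "0 < (2::nat) ^ k" by simp
  show ?case
  proof (cases "n < lo + 2 ^ k")
    case True
    then have "\<pi> j < lo + 2 ^ k" using permutes_lessThan_less[OF assms(1,2)] by simp
    from Suc.IH[OF Suc.prems(1) this] True show ?thesis by simp
  next
    case False
    then have "lo + 2 ^ k - 1 < n" using pos by linarith
    \<comment> \<open>The queried row is the last one of the lower half of the interval, so answer 1
      means that \<open>\<pi> j\<close> lies in the lower half.\<close>
    then have idx: "M $$ (lo + 2 ^ k - 1, j) \<longleftrightarrow> \<pi> j < lo + 2 ^ k"
      using perm_half_graph_index[OF assms(1) _ assms(2)] pos unfolding M_def by fastforce
    show ?thesis
    proof (cases "\<pi> j < lo + 2 ^ k")
      case True
      from Suc.IH[OF Suc.prems(1) this] False idx True show ?thesis by simp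
    next
      case ge: False
      have "\<pi> j < lo + 2 ^ k + 2 ^ k" using Suc.prems by simp
      from Suc.IH[OF _ this] ge False idx show ?thesis by simp
    qed
  qed
qed

lemma queries_within_search_cols: "m \<le> n \<Longrightarrow> queries_within n (search_cols n k m f)"
  by (induction m arbitrary: f) (simp_all add: queries_within_search_col)

text \<open>The invariant is that \<open>f\<close> is right on the columns already searched, those
  from \<open>m\<close> on. For \<open>m = n\<close> it is vacuous, so any initial \<open>f\<close>
  will do.\<close>

lemma search_cols_correct:
  assumes "\<pi> permutes {..<n}" "n \<le> 2 ^ k" "m \<le> n" "\<forall>j. m \<le> j \<longrightarrow> j < n \<longrightarrow> f j = \<pi> j"
  defines "M \<equiv> perm_half_graph n \<pi>"
  shows "tree_output (search_cols n k m f) M = M \<and> num_queries (search_cols n k m f) M \<le> m * k"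
  using assms(3,4)
proof (induction m arbitrary: f)
  case 0
  then have "perm_half_graph n f = M"
    unfolding M_def perm_half_graph_def by (intro eq_matI) auto
  then show ?case by simp
next
  case (Suc m)
  have m: "m < n" using Suc.prems by simp
  have b: "\<pi> m < 0 + 2 ^ k" using permutes_lessThan_less[OF assms(1) m] assms(2) by simp
  have "\<forall>j. m \<le> j \<longrightarrow> j < n \<longrightarrow> (f(m := \<pi> m)) j = \<pi> j" using Suc.prems by auto
  from Suc.IH[OF _ this] m
    search_col_correct[OF assms(1) m _ b, of "\<lambda>v. search_cols n k m (f(m := v))", folded M_def]
  show ?case by (simp del: fun_upd_apply)
qed

lemma det_learns_half_graphs:
  assumes "n \<le> 2 ^ k"
  shows "det_learns n (col_permuted_half_graphs n) (n * k)"
  unfolding det_learns_def col_permuted_half_graphs_eq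
  using queries_within_search_cols[of n n k id] search_cols_correct[OF _ assms, of _ n id]
  by auto


section \<open>Deterministic algorithms as randomized ones, and counting leaves\<close>

lemma det_learns_imp_rand_learns: "det_learns n X T \<Longrightarrow> rand_learns n X T"
proof -
  assume "det_learns n X T"
  then obtain t where t: "queries_within n t" "\<forall>M\<in>X. tree_output t M = M \<and> num_queries t M \<le> T"
    unfolding det_learns_def by blast
  show ?thesis unfolding rand_learns_def
    using t by (intro exI[of _ "return_pmf t"]) auto
qed

text \<open>A leaf is right on at most one matrix, and a query splits \<open>X\<close> by the answer
  into two sets whose remaining budget is one smaller. A nonempty \<open>X\<close> guarantees that
  there is budget left to spend.\<close>

lemma card_correct_outputs_le:
  assumes "finite X" "\<forall>M\<in>X. num_queries t M \<le> T"
  shows "card {M \<in> X. tree_output t M = M} \<le> 2 ^ T"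
  using assms
proof (induction t arbitrary: X T)
  case (Output A)
  have "card {M \<in> X. tree_output (Output A) M = M} \<le> card {A}"
    by (rule card_mono) auto
  also have "\<dots> \<le> 2 ^ T" by simp
  finally show ?case .
next
  case (Query i j t0 t1)
  show ?case
  proof (cases "X = {}")
    case False
    with Query.prems obtain T' where T: "T = Suc T'"
      by (cases T) auto
    let ?X = "\<lambda>b. {M \<in> X. M $$ (i, j) = b}"
    have "card {M \<in> ?X False. tree_output t0 M = M} \<le> 2 ^ T'"
      by (rule Query.IH(1)) (use Query.prems T in auto)
    moreover have "card {M \<in> ?X True. tree_output t1 M = M} \<le> 2 ^ T'"
      by (rule Query.IH(2)) (use Query.prems T in auto)
    moreover have "{M \<in> X. tree_output (Query i j t0 t1) M = M} =
      {M \<in> ?X False. tree_output t0 M = M} \<union> {M \<in> ?X True. tree_output t1 M = M}"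
      by auto
    ultimately show ?thesis
      using card_Un_le[of "{M \<in> ?X False. tree_output t0 M = M}" "{M \<in> ?X True. tree_output t1 M = M}"] T
      by simp
  qed simp
qed

text \<open>Averaging: the expected number of matrices answered correctly is at least
  \<open>2/3 * card X\<close>, while no tree in the support is right on more than
  \<open>2 ^ T\<close> of them.\<close>

lemma rand_learns_card_le:
  assumes "finite X" "rand_learns n X T"
  shows "2 / 3 * real (card X) \<le> 2 ^ T"
proof -
  from assms(2) obtain p where p: "\<forall>t\<in>set_pmf p. \<forall>M\<in>X. num_queries t M \<le> T"
    "\<forall>M\<in>X. measure_pmf.prob p {t. tree_output t M = M} \<ge> 2 / 3"
    unfolding rand_learns_def by blast
  let ?E = "\<lambda>M. {t. tree_output t M = M}"
  have "2 / 3 * real (card X) = (\<Sum>M\<in>X. 2 / 3)" by simp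
  also have "\<dots> \<le> (\<Sum>M\<in>X. measure_pmf.prob p (?E M))"
    using p(2) by (intro sum_mono) auto
  also have "\<dots> = (\<Sum>M\<in>X. measure_pmf.expectation p (indicator (?E M)))" by simp
  also have "\<dots> = measure_pmf.expectation p (\<lambda>t. \<Sum>M\<in>X. indicator (?E M) t)"
    by (rule Bochner_Integration.integral_sum[symmetric]) (simp add: measure_pmf.integrable_const_bound[where B=1])
  also have "\<dots> \<le> 2 ^ T"
  proof (rule measure_pmf.integral_le_const)
    show "integrable (measure_pmf p) (\<lambda>t. \<Sum>M\<in>X. indicator (?E M) t :: real)"
      by (intro Bochner_Integration.integrable_sum) (simp add: measure_pmf.integrable_const_bound[where B=1])
    have "(\<Sum>M\<in>X. indicator (?E M) t :: real) \<le> 2 ^ T" if "t \<in> set_pmf p" for t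
    proof -
      have "(\<Sum>M\<in>X. indicator (?E M) t :: real) = (\<Sum>M\<in>X. of_bool (tree_output t M = M))"
        by (intro sum.cong) (auto simp: indicator_def)
      also have "\<dots> = real (card {M \<in> X. tree_output t M = M})"
        using assms(1) by (simp add: Int_def)
      also have "\<dots> \<le> 2 ^ T"
        using card_correct_outputs_le[OF assms(1), of t T] p(1) that
        by (metis numeral_power_eq_of_nat_cancel_iff of_nat_le_iff)
      finally show ?thesis .
    qed
    then show "AE t in measure_pmf p. (\<Sum>M\<in>X. indicator (?E M) t :: real) \<le> 2 ^ T"
      by (simp add: AE_measure_pmf_iff)
  qed
  finally show ?thesis .
qed

text \<open>Pair the factor \<open>k\<close> of one factorial with \<open>n + 1 - k\<close> of the
  other; each product is at least \<open>n\<close>. This replaces Stirling's formula.\<close>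

lemma power_self_le_fact_square: "n ^ n \<le> (fact n)\<^sup>2"
proof -
  have "n ^ n = (\<Prod>k\<in>{1..n}. n)" by simp
  also have "\<dots> \<le> (\<Prod>k\<in>{1..n}. k * (n + 1 - k))"
  proof (rule prod_mono, clarsimp)
    fix k assume k: "Suc 0 \<le> k" "k \<le> n"
    then obtain d where "n = k + d" using le_Suc_ex by blast
    moreover obtain l where "k = Suc l" using k by (cases k) auto
    \<comment> \<open>With \<open>k = l + 1\<close> and \<open>n = k + d\<close> the product is
      \<open>(l + 1) * (d + 1) = n + l * d\<close>.\<close>
    ultimately show "n \<le> k * (Suc n - k)" by simp
  qed
  also have "\<dots> = (\<Prod>k\<in>{1..n}. k) * (\<Prod>k\<in>{1..n}. n + 1 - k)"
    by (simp add: prod.distrib)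
  also have "(\<Prod>k\<in>{1..n}. n + 1 - k) = (\<Prod>k\<in>{1..n}. k)"
    by (rule prod.reindex_bij_witness[of _ "\<lambda>k. n + 1 - k" "\<lambda>k. n + 1 - k"]) auto
  finally show ?thesis by (simp add: fact_prod power2_eq_square)
qed

text \<open>Squaring the counting bound gives \<open>4/9 * n ^ n \<le> 2 ^ (2 * T)\<close>, so
  \<open>2 * T\<close> is at least \<open>L - 3/2\<close> with \<open>L = n log n\<close>. For
  \<open>n \<ge> 2\<close> we have \<open>L \<ge> 2\<close>, so \<open>3/2\<close> is at most
  \<open>3/4 * L\<close> and \<open>L / 8\<close> remains for \<open>T\<close>; for
  \<open>n = 1\<close> the claim is trivial.\<close>

lemma rand_learns_half_graphs_lower:
  assumes "rand_learns n (col_permuted_half_graphs n) T" "n \<ge> 1"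
  shows "1 / 8 * (real n * log 2 (real n)) \<le> real T"
proof (cases "n = 1")
  case False
  define L where "L = real n * log 2 (real n)"
  have n: "n \<ge> 2" using assms False by simp
  have "log 2 2 \<le> log 2 (real n)" using n by (subst log_le_cancel_iff) auto
  then have "2 * 1 \<le> L" unfolding L_def using n by (intro mult_mono) auto
  have "2 / 3 * real (fact n) \<le> 2 ^ T"
    using rand_learns_card_le[OF finite_col_permuted_half_graphs assms(1)]
    by (simp add: card_col_permuted_half_graphs)
  then have "(2 / 3 * real (fact n))\<^sup>2 \<le> (2 ^ T)\<^sup>2" by (rule power_mono) simp
  moreover have "real n ^ n \<le> (real (fact n))\<^sup>2"
    using power_self_le_fact_square[of n] by (metis of_nat_le_iff of_nat_power)
  ultimately have "4 / 9 * real n ^ n \<le> 2 ^ (2 * T)"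
    by (simp add: power_mult_distrib power_divide power_mult mult.commute[of 2 T])
  then have "log 2 (4 / 9 * real n ^ n) \<le> log 2 (2 ^ (2 * T))"
    using n by (subst log_le_cancel_iff) auto
  then have "log 2 (4 / 9) + L \<le> 2 * real T"
    using n log_mult[of 2 "4 / 9" "real n ^ n"] by (simp add: L_def log_nat_power)
  \<comment> \<open>This amounts to \<open>1/8 \<le> (4/9) ^ 2 = 16/81\<close>.\<close>
  moreover have "- 3 / 2 \<le> log 2 (4 / 9)"
  proof -
    have "- 3 = log 2 (2 powr - 3)" by simp
    also have "(2::real) powr - 3 = 1 / 8" by (simp add: powr_minus_divide)
    also have "log 2 (1 / 8) \<le> log 2 ((4 / 9) ^ 2)" by (subst log_le_cancel_iff) (auto simp: power2_eq_square)
    also have "\<dots> = 2 * log 2 (4 / 9)" by (subst log_nat_power) auto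
    finally show ?thesis by simp
  qed
  ultimately show ?thesis using \<open>2 * 1 \<le> L\<close> unfolding L_def by linarith
qed simp


section \<open>Quantum simulation of decision trees\<close>

lemma finite_labels [simp]: "finite (labels n w)"
  by (simp add: labels_def)

section \<open>Basis states and permutation matrices\<close>

lemma apply_op_ket:
  assumes "finite B" "y \<in> B"
  shows "apply_op B U (ket y) = (\<lambda>x. U x y)"
proof
  fix x
  have "apply_op B U (ket y) x = (\<Sum>z\<in>B. if z = y then U x z else 0)"
    unfolding apply_op_def ket_def by (intro sum.cong) auto
  then show "apply_op B U (ket y) x = U x y" using assms by simp
qed

lemma oracle_op_ket:
  assumes "(i, j, b, a) \<in> labels n w"
  shows "apply_op (labels n w) (oracle_op M) (ket (i, j, b, a)) = ket (i, j, b \<noteq> M $$ (i, j), a)"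
  using apply_op_ket[OF finite_labels assms] by (simp add: oracle_op_def)

text \<open>The complements of \<open>S\<close> and of its image are equinumerous, so any bijection
  between them completes \<open>g\<close>.\<close>

lemma inj_on_extends_to_bij_betw:
  assumes "finite B" "S \<subseteq> B" "inj_on g S" "g ` S \<subseteq> B"
  obtains p where "bij_betw p B B" "\<And>y. y \<in> S \<Longrightarrow> p y = g y"
proof -
  have "card (B - S) = card (B - g ` S)"
    using assms by (simp add: card_Diff_subset finite_subset card_image)
  then obtain h where h: "bij_betw h (B - S) (B - g ` S)"
    using assms(1) by (metis finite_Diff finite_same_card_bij)
  define p where "p y = (if y \<in> S then g y else h y)" for y
  have "bij_betw p S (g ` S)"
    using assms(3) by (simp add: bij_betw_def inj_on_def p_def)
  moreover have "bij_betw p (B - S) (B - g ` S)"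
    using h by (subst bij_betw_cong[of _ _ h]) (auto simp: p_def)
  ultimately have "bij_betw p (S \<union> (B - S)) (g ` S \<union> (B - g ` S))"
    by (rule bij_betw_combine) auto
  then have "bij_betw p B B" using assms(2,4) by (simp add: Un_absorb1)
  then show ?thesis using that p_def by simp
qed

text \<open>Turns a reversible classical step into a quantum gate: the matrix of a permutation of
  the basis is unitary, and its action outside \<open>S\<close> may be arbitrary.\<close>

lemma ex_unitary_op_inj_on:
  assumes "finite B" "S \<subseteq> B" "inj_on g S" "g ` S \<subseteq> B"
  shows "\<exists>U. unitary_op B U \<and> (\<forall>y\<in>S. apply_op B U (ket y) = ket (g y))"
proof -
  obtain p where p: "bij_betw p B B" "\<And>y. y \<in> S \<Longrightarrow> p y = g y"
    using inj_on_extends_to_bij_betw[OF assms] by blast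
  define U :: "label \<Rightarrow> label \<Rightarrow> complex" where "U x y = ket (p y) x" for x y
  have "(\<Sum>z\<in>B. cnj (U z x) * U z y) = of_bool (x = y)" if "x \<in> B" "y \<in> B" for x y
  proof -
    have "(\<Sum>z\<in>B. cnj (U z x) * U z y) = (\<Sum>z\<in>B. if z = p x then of_bool (p x = p y) else 0)"
      unfolding U_def ket_def by (intro sum.cong) auto
    also have "\<dots> = of_bool (p x = p y)"
      using assms(1) that p(1) by (auto simp: bij_betw_def)
    also have "p x = p y \<longleftrightarrow> x = y"
      using p(1) that by (auto simp: bij_betw_def inj_on_def)
    finally show ?thesis .
  qed
  then have "unitary_op B U" by (simp add: unitary_op_def)
  moreover have "apply_op B U (ket y) = ket (g y)" if "y \<in> S" for y
    using apply_op_ket[OF assms(1), of y U] that assms(2) p(2) by (auto simp: U_def)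
  ultimately show ?thesis by blast
qed

text \<open>The junk position at a leaf is a legal query whenever \<open>n > 0\<close>, so that trees of different
  depths are run for the same number of steps.\<close>

fun query_pos :: "dtree \<Rightarrow> nat \<times> nat" where
  "query_pos (Output A) = (0, 0)"
| "query_pos (Query i j t0 t1) = (i, j)"

fun child :: "dtree \<Rightarrow> bool \<Rightarrow> dtree" where
  "child (Output A) b = Output A"
| "child (Query i j t0 t1) b = (if b then t1 else t0)"

section \<open>Following a tree along a list of answers\<close>

abbreviation descend :: "dtree \<Rightarrow> bool list \<Rightarrow> dtree" where
  "descend \<equiv> foldl child"

fun transcript :: "dtree \<Rightarrow> bool mat \<Rightarrow> nat \<Rightarrow> bool list" where
  "transcript t M 0 = []"
| "transcript t M (Suc k) = transcript t M k @ [M $$ query_pos (descend t (transcript t M k))]"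

lemma length_transcript [simp]: "length (transcript t M k) = k"
  by (induction k) auto

lemma tree_output_child [simp]: "tree_output (child t (M $$ query_pos t)) M = tree_output t M"
  by (cases t) auto

text \<open>Truncated subtraction covers the leaf, where \<open>0 - 1 = 0\<close>.\<close>

lemma num_queries_child [simp]: "num_queries (child t (M $$ query_pos t)) M = num_queries t M - 1"
  by (cases t) auto

lemma tree_output_descend_transcript:
  "tree_output (descend t (transcript t M k)) M = tree_output t M"
  by (induction k) auto

lemma num_queries_descend_transcript:
  "num_queries (descend t (transcript t M k)) M = num_queries t M - k"
  by (induction k) auto

lemma queries_within_descend: "queries_within n t \<Longrightarrow> queries_within n (descend t h)"
proof (induction h arbitrary: t)
  case (Cons b h)
  have "queries_within n (child t b)" using Cons.prems by (cases t) auto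
  then show ?case using Cons.IH by simp
qed simp

lemma query_pos_within:
  assumes "queries_within n t" "n > 0"
  shows "fst (query_pos t) < n \<and> snd (query_pos t) < n"
  using assms by (cases t) auto

text \<open>The basis state that is about to make the query \<open>t\<close> asks after the answers
  \<open>h\<close>. With answer bit \<open>False\<close> the exclusive or of the oracle writes the
  answer itself.\<close>

definition history_label :: "dtree \<Rightarrow> bool list \<Rightarrow> bool \<Rightarrow> label" where
  "history_label t h b = (fst (query_pos (descend t h)), snd (query_pos (descend t h)), b, to_nat h)"

text \<open>The answer bit is moved into the history kept in the work register. This is injective since
  the history determines the query position, hence it extends to a permutation of the basis.\<close>

lemma det_learns_imp_quantum_learns:
  assumes "det_learns n X T" "n > 0"
  shows "quantum_learns n X T"
proof -
  obtain t where t: "queries_within n t" "\<forall>M\<in>X. tree_output t M = M \<and> num_queries t M \<le> T"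
    using assms(1) unfolding det_learns_def by blast
  define H where "H = {h :: bool list. set h \<subseteq> UNIV \<and> length h \<le> T}"
  have finH: "finite H" unfolding H_def by (rule finite_lists_length_le) simp
  \<comment> \<open>The register holds the code of every history of length at most
    \<open>T\<close>.\<close>
  define w where "w = Suc (Max (to_nat ` H))"
  define B where "B = labels n w"
  have finB: "finite B" by (simp add: B_def)
  have label: "history_label t h b \<in> B" if "length h \<le> T" for h b
  proof -
    have "to_nat h \<le> Max (to_nat ` H)" using that finH by (intro Max_ge) (auto simp: H_def)
    then show ?thesis
      using query_pos_within[OF queries_within_descend[OF t(1)] assms(2)]
      by (simp add: history_label_def B_def labels_def w_def)
  qed
  have inj: "h = h' \<and> b = b'" if "history_label t h b = history_label t h' b'" for h h' b b'
    using that by (simp add: history_label_def)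
  have zero: "(0, 0, False, 0) \<in> B" using assms(2) by (simp add: B_def labels_def w_def)
  \<comment> \<open>The prescribed start need not be the label of the root query, so the first
    unitary moves it there; a map on one point is trivially injective.\<close>
  have "\<exists>U. unitary_op B U \<and> (\<forall>y\<in>{(0, 0, False, 0)}. apply_op B U (ket y) = ket (history_label t [] False))"
    by (rule ex_unitary_op_inj_on[where g = "\<lambda>_. history_label t [] False"])
      (use finB zero label[of "[]" False] in auto)
  then obtain U0 where U0: "unitary_op B U0"
    "apply_op B U0 (ket (0, 0, False, 0)) = ket (history_label t [] False)" by auto
  have "\<exists>U. unitary_op B U \<and> (\<forall>h b. length h = k \<longrightarrow>
      apply_op B U (ket (history_label t h b)) = ket (history_label t (h @ [b]) False))"
    if k: "k < T" for k
  proof -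
    define S where "S = {history_label t h b | h b. length h = k}"
    define g where "g y = (case y of (i, j, b, a) \<Rightarrow> history_label t (from_nat a @ [b]) False)" for y :: label
    have g: "g (history_label t h b) = history_label t (h @ [b]) False" for h b
      by (simp add: g_def history_label_def[of t h b])
    obtain U where "unitary_op B U" "\<forall>y\<in>S. apply_op B U (ket y) = ket (g y)"
    proof (atomize_elim, rule ex_unitary_op_inj_on[OF finB])
      show "S \<subseteq> B" using label k by (auto simp: S_def)
      show "g ` S \<subseteq> B" using label k by (auto simp: S_def g)
      show "inj_on g S"
      proof (rule inj_onI)
        fix x y assume "x \<in> S" "y \<in> S" and eq: "g x = g y"
        then obtain h b h' b' where "x = history_label t h b" "y = history_label t h' b'"
          unfolding S_def by blast
        with eq show "x = y" using inj[of "h @ [b]" False "h' @ [b']" False] by (simp add: g)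
      qed
    qed
    moreover have "history_label t h b \<in> S" if "length h = k" for h b
      using that unfolding S_def by blast
    ultimately show ?thesis using g by (intro exI[of _ U]) simp
  qed
  then obtain V where V: "\<And>k. k < T \<Longrightarrow> unitary_op B (V k)"
    "\<And>k h b. k < T \<Longrightarrow> length h = k \<Longrightarrow>
      apply_op B (V k) (ket (history_label t h b)) = ket (history_label t (h @ [b]) False)"
    by metis
  define U where "U k = (case k of 0 \<Rightarrow> U0 | Suc k \<Rightarrow> V k)" for k
  have run: "run_quantum B U M k = ket (history_label t (transcript t M k) False)" if "k \<le> T" for M k
    using that
  proof (induction k)
    case 0
    then show ?case using U0 by (simp add: U_def)
  next
    case (Suc k)
    let ?h = "transcript t M k"
    let ?b = "M $$ query_pos (descend t ?h)"
    have "history_label t ?h False \<in> B" using label Suc.prems by simp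
    then have "apply_op B (oracle_op M) (ket (history_label t ?h False)) = ket (history_label t ?h ?b)"
      unfolding B_def history_label_def by (subst oracle_op_ket) auto
    then show ?case using Suc V(2)[of k ?h ?b] by (simp add: U_def)
  qed
  \<comment> \<open>After a full transcript the tree reached is a leaf, whose output ignores the
    matrix; hence \<open>undefined\<close>.\<close>
  define out where "out y = (case y of (i, j, b, a) \<Rightarrow>
    tree_output (descend t (from_nat a)) undefined)" for y :: label
  have "output_prob B out (run_quantum B U M T) M \<ge> 2 / 3" if "M \<in> X" for M
  proof -
    let ?y = "history_label t (transcript t M T) False"
    let ?t = "descend t (transcript t M T)"
    have "num_queries ?t M = 0" using t(2) that by (simp add: num_queries_descend_transcript)
    moreover have "tree_output ?t M = M" using t(2) that by (simp add: tree_output_descend_transcript)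
    ultimately have "?t = Output M" by (cases ?t) auto
    then have out: "out ?y = M" by (simp add: out_def history_label_def)
    have "output_prob B out (ket ?y) M = (\<Sum>x | x \<in> B \<and> out x = M. if x = ?y then 1 else 0)"
      unfolding output_prob_def ket_def by (intro sum.cong) auto
    also have "\<dots> = 1" using finB label[of "transcript t M T" False] out by simp
    finally show ?thesis by (simp add: run)
  qed
  moreover have "unitary_op B (U k)" if "k \<le> T" for k
    using that U0(1) V(1) by (cases k) (auto simp: U_def)
  ultimately show ?thesis
    unfolding quantum_learns_def B_def by (intro exI[of _ w] exI[of _ U] exI[of _ out]) (simp add: w_def)
qed


section \<open>The quantum lower bound\<close>

definition dist_sq :: "label set \<Rightarrow> (label \<Rightarrow> complex) \<Rightarrow> (label \<Rightarrow> complex) \<Rightarrow> real" where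
  "dist_sq B \<phi> \<psi> = (\<Sum>x\<in>B. (cmod (\<phi> x - \<psi> x))\<^sup>2)"

lemma apply_op_unitary_norm:
  assumes "finite B" "unitary_op B U"
  shows "(\<Sum>x\<in>B. (cmod (apply_op B U \<psi> x))\<^sup>2) = (\<Sum>x\<in>B. (cmod (\<psi> x))\<^sup>2)"
proof -
  have "complex_of_real (\<Sum>x\<in>B. (cmod (apply_op B U \<psi> x))\<^sup>2)
    = (\<Sum>x\<in>B. (\<Sum>y\<in>B. cnj (U x y * \<psi> y)) * (\<Sum>z\<in>B. U x z * \<psi> z))"
    unfolding of_real_sum complex_norm_square apply_op_def cnj_sum
    by (intro sum.cong refl mult.commute)
  also have "\<dots> = (\<Sum>x\<in>B. \<Sum>y\<in>B. \<Sum>z\<in>B. cnj (\<psi> y) * \<psi> z * (cnj (U x y) * U x z))"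
    unfolding sum_product by (simp add: mult_ac)
  also have "\<dots> = (\<Sum>y\<in>B. \<Sum>z\<in>B. \<Sum>x\<in>B. cnj (\<psi> y) * \<psi> z * (cnj (U x y) * U x z))"
    by (subst sum.swap, rule sum.cong[OF refl], rule sum.swap)
  also have "\<dots> = (\<Sum>y\<in>B. \<Sum>z\<in>B. cnj (\<psi> y) * \<psi> z * of_bool (y = z))"
    using assms(2) by (simp add: unitary_op_def sum_distrib_left[symmetric])
  also have "\<dots> = (\<Sum>y\<in>B. \<Sum>z\<in>B. if y = z then cnj (\<psi> y) * \<psi> z else 0)"
    by (intro sum.cong) auto
  also have "\<dots> = (\<Sum>y\<in>B. cnj (\<psi> y) * \<psi> y)"
    using assms(1) by simp
  also have "\<dots> = complex_of_real (\<Sum>y\<in>B. (cmod (\<psi> y))\<^sup>2)"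
    unfolding of_real_sum complex_norm_square by (intro sum.cong refl mult.commute)
  finally show ?thesis by (simp only: of_real_eq_iff)
qed

lemma dist_sq_unitary:
  assumes "finite B" "unitary_op B U"
  shows "dist_sq B (apply_op B U \<phi>) (apply_op B U \<psi>) = dist_sq B \<phi> \<psi>"
  using apply_op_unitary_norm[OF assms, of "\<lambda>x. \<phi> x - \<psi> x"]
  by (simp add: dist_sq_def apply_op_def sum_subtractf right_diff_distrib)

section \<open>The oracle as a permutation of labels\<close>

abbreviation label_pos :: "label \<Rightarrow> nat \<times> nat" where
  "label_pos x \<equiv> (fst x, fst (snd x))"

definition flip_label :: "bool mat \<Rightarrow> label \<Rightarrow> label" where
  "flip_label M x = (case x of (i, j, b, a) \<Rightarrow> (i, j, b \<noteq> M $$ (i, j), a))"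

lemma label_pos_flip [simp]: "label_pos (flip_label M x) = label_pos x"
  by (simp add: flip_label_def split: prod.splits)

lemma flip_label_flip [simp]: "flip_label M (flip_label M x) = x"
  by (auto simp: flip_label_def split: prod.splits)

lemma flip_label_in_labels [simp]: "flip_label M x \<in> labels n w \<longleftrightarrow> x \<in> labels n w"
  by (auto simp: flip_label_def labels_def split: prod.splits)

lemma flip_label_cong:
  "M $$ label_pos x = M' $$ label_pos x \<Longrightarrow> flip_label M x = flip_label M' x"
  by (auto simp: flip_label_def split: prod.splits)

lemma apply_oracle_op:
  assumes "x \<in> labels n w"
  shows "apply_op (labels n w) (oracle_op M) \<psi> x = \<psi> (flip_label M x)"
proof -
  have "oracle_op M x y = of_bool (y = flip_label M x)" for y
    unfolding oracle_op_def ket_def flip_label_def by (auto split: prod.splits)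
  then have "apply_op (labels n w) (oracle_op M) \<psi> x
    = (\<Sum>y\<in>labels n w. if y = flip_label M x then \<psi> y else 0)"
    unfolding apply_op_def by (intro sum.cong) auto
  also have "\<dots> = \<psi> (flip_label M x)" using assms by simp
  finally show ?thesis .
qed

text \<open>The flip is an involution preserving query positions, so it permutes the labels over any
  set of positions. The oracle thus never changes the mass on such a set.\<close>

lemma sum_flip_label:
  "(\<Sum>x | x \<in> labels n w \<and> P (label_pos x). f (flip_label M x)) =
   (\<Sum>x | x \<in> labels n w \<and> P (label_pos x). f x)"
by (rule sum.reindex_bij_witness[of _ "flip_label M" "flip_label M"])
    (simp_all add: label_pos_flip[unfolded prod.inject])

lemma cmod_diff_square_le: "(cmod (a - b))\<^sup>2 \<le> 2 * (cmod a)\<^sup>2 + 2 * (cmod b)\<^sup>2"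
proof -
  have "(cmod (a - b))\<^sup>2 \<le> (cmod a + cmod b)\<^sup>2"
    by (intro power_mono norm_triangle_ineq4) simp
  also have "\<dots> \<le> 2 * (cmod a)\<^sup>2 + 2 * (cmod b)\<^sup>2"
    using zero_le_power2[of "cmod a - cmod b"] by (simp add: power2_eq_square algebra_simps)
  finally show ?thesis .
qed

text \<open>For a unit vector, the probability that measuring the query register yields a position
  in \<open>P\<close>.\<close>

definition query_mass :: "nat \<Rightarrow> nat \<Rightarrow> (nat \<times> nat) set \<Rightarrow> (label \<Rightarrow> complex) \<Rightarrow> real" where
  "query_mass n w P \<psi> = (\<Sum>x | x \<in> labels n w \<and> label_pos x \<in> P. (cmod (\<psi> x))\<^sup>2)"

text \<open>Off \<open>P\<close> both oracles permute amplitudes in the same way, which costs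
  nothing. On \<open>P\<close> the new distance is bounded by the masses alone.\<close>

lemma dist_sq_oracle_le:
  fixes n w M M'
  defines "B \<equiv> labels n w" and "P \<equiv> {p. M $$ p \<noteq> M' $$ p}"
  shows "dist_sq B (apply_op B (oracle_op M) \<phi>) (apply_op B (oracle_op M') \<psi>)
    \<le> dist_sq B \<phi> \<psi> + 2 * (query_mass n w P \<phi> + query_mass n w P \<psi>)"
proof -
  let ?S = "{x. x \<in> B \<and> label_pos x \<in> P}" and ?R = "{x. x \<in> B \<and> label_pos x \<notin> P}"
  have split: "(\<Sum>x\<in>B. f x) = (\<Sum>x\<in>?R. f x) + (\<Sum>x\<in>?S. f x)" for f :: "label \<Rightarrow> real"
    unfolding B_def by (subst sum.union_disjoint[symmetric]) (auto intro!: sum.cong)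
  have "dist_sq B (apply_op B (oracle_op M) \<phi>) (apply_op B (oracle_op M') \<psi>)
    = (\<Sum>x\<in>B. (cmod (\<phi> (flip_label M x) - \<psi> (flip_label M' x)))\<^sup>2)"
    unfolding dist_sq_def B_def by (intro sum.cong) (auto simp: apply_oracle_op)
  also have "\<dots> = (\<Sum>x\<in>?R. (cmod (\<phi> (flip_label M x) - \<psi> (flip_label M' x)))\<^sup>2)
    + (\<Sum>x\<in>?S. (cmod (\<phi> (flip_label M x) - \<psi> (flip_label M' x)))\<^sup>2)" by (rule split)
  also have "(\<Sum>x\<in>?R. (cmod (\<phi> (flip_label M x) - \<psi> (flip_label M' x)))\<^sup>2)
    = (\<Sum>x\<in>?R. (cmod (\<phi> (flip_label M x) - \<psi> (flip_label M x)))\<^sup>2)"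
  proof (rule sum.cong[OF refl])
    fix x assume "x \<in> ?R"
    then have "flip_label M x = flip_label M' x" by (intro flip_label_cong) (simp add: P_def)
    then show "(cmod (\<phi> (flip_label M x) - \<psi> (flip_label M' x)))\<^sup>2
      = (cmod (\<phi> (flip_label M x) - \<psi> (flip_label M x)))\<^sup>2" by simp
  qed
  also have "\<dots> = (\<Sum>x\<in>?R. (cmod (\<phi> x - \<psi> x))\<^sup>2)"
    unfolding B_def by (rule sum_flip_label[where f = "\<lambda>x. (cmod (\<phi> x - \<psi> x))\<^sup>2" and P = "\<lambda>p. p \<notin> P"])
  also have "\<dots> \<le> dist_sq B \<phi> \<psi>"
    unfolding dist_sq_def B_def by (intro sum_mono2) auto
  also have "(\<Sum>x\<in>?S. (cmod (\<phi> (flip_label M x) - \<psi> (flip_label M' x)))\<^sup>2)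
    \<le> (\<Sum>x\<in>?S. 2 * (cmod (\<phi> (flip_label M x)))\<^sup>2 + 2 * (cmod (\<psi> (flip_label M' x)))\<^sup>2)"
    by (intro sum_mono cmod_diff_square_le)
  also have "\<dots> = 2 * (query_mass n w P \<phi> + query_mass n w P \<psi>)"
    unfolding query_mass_def B_def
    using sum_flip_label[where f = "\<lambda>x. (cmod (\<phi> x))\<^sup>2" and P = "\<lambda>p. p \<in> P"]
      sum_flip_label[where f = "\<lambda>x. (cmod (\<psi> x))\<^sup>2" and P = "\<lambda>p. p \<in> P"]
    by (simp add: sum.distrib sum_distrib_left[symmetric])
  finally show ?thesis by simp
qed

lemma norm_run_quantum:
  assumes "n > 0" "w > 0" "\<forall>t\<le>T. unitary_op (labels n w) (U t)"
  shows "(\<Sum>x\<in>labels n w. (cmod (run_quantum (labels n w) U M T x))\<^sup>2) = 1"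
  using assms(3)
proof (induction T)
  case 0
  have "(0, 0, False, 0) \<in> labels n w" using assms by (simp add: labels_def)
  moreover have "(\<Sum>x\<in>labels n w. (cmod (ket (0, 0, False, 0) x))\<^sup>2)
    = (\<Sum>x\<in>labels n w. if x = (0, 0, False, 0) then 1 else 0)"
    unfolding ket_def by (intro sum.cong) auto
  ultimately show ?case using 0 by (simp add: apply_op_unitary_norm)
next
  case (Suc T)
  have "(\<Sum>x\<in>labels n w. (cmod (\<psi> (flip_label M x)))\<^sup>2) = (\<Sum>x\<in>labels n w. (cmod (\<psi> x))\<^sup>2)" for \<psi>
    using sum_flip_label[where f = "\<lambda>x. (cmod (\<psi> x))\<^sup>2" and P = "\<lambda>_. True"] by simp
  then show ?case using Suc by (simp add: apply_op_unitary_norm apply_oracle_op)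
qed

text \<open>The constant comes from \<open>|a|\<^sup>2 \<le> 3/2 |b|\<^sup>2 + 3 |a - b|\<^sup>2\<close>, summed over the outcomes
  answered with \<open>A\<close>: these have weight at least \<open>2/3\<close> in one state and at most \<open>1/3\<close> in the other.\<close>

lemma dist_sq_ge_of_output_prob:
  assumes "finite B" "A \<noteq> A'"
    and "output_prob B out \<phi> A \<ge> 2 / 3" "output_prob B out \<psi> A' \<ge> 2 / 3"
    and "(\<Sum>x\<in>B. (cmod (\<psi> x))\<^sup>2) = 1"
  shows "dist_sq B \<phi> \<psi> \<ge> 1 / 18"
proof -
  let ?E = "{x. x \<in> B \<and> out x = A}"
  have "output_prob B out \<psi> A + output_prob B out \<psi> A' =
    (\<Sum>x\<in>?E \<union> {x. x \<in> B \<and> out x = A'}. (cmod (\<psi> x))\<^sup>2)"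
    unfolding output_prob_def using assms(1,2) by (intro sum.union_disjoint[symmetric]) auto
  also have "\<dots> \<le> 1" unfolding assms(5)[symmetric] using assms(1) by (intro sum_mono2) auto
  finally have le: "output_prob B out \<psi> A \<le> 1 / 3" using assms(4) by simp
  have pointwise: "(cmod a)\<^sup>2 \<le> 3 / 2 * (cmod b)\<^sup>2 + 3 * (cmod (a - b))\<^sup>2" for a b
  proof -
    have "cmod a \<le> cmod b + cmod (a - b)" using norm_triangle_ineq[of b "a - b"] by simp
    then have "(cmod a)\<^sup>2 \<le> (cmod b + cmod (a - b))\<^sup>2" by (intro power_mono) auto
    \<comment> \<open>The right side exceeds the left by half the square of
      \<open>cmod b - 2 * cmod (a - b)\<close>.\<close>
    also have "\<dots> \<le> 3 / 2 * (cmod b)\<^sup>2 + 3 * (cmod (a - b))\<^sup>2"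
      using zero_le_power2[of "cmod b - 2 * cmod (a - b)"] by (simp add: power2_eq_square algebra_simps)
    finally show ?thesis .
  qed
  have "2 / 3 \<le> (\<Sum>x\<in>?E. (cmod (\<phi> x))\<^sup>2)" using assms(3) by (simp add: output_prob_def)
  also have "\<dots> \<le> (\<Sum>x\<in>?E. 3 / 2 * (cmod (\<psi> x))\<^sup>2 + 3 * (cmod (\<phi> x - \<psi> x))\<^sup>2)"
    by (intro sum_mono pointwise)
  also have "\<dots> = 3 / 2 * output_prob B out \<psi> A + 3 * (\<Sum>x\<in>?E. (cmod (\<phi> x - \<psi> x))\<^sup>2)"
    by (simp add: sum.distrib sum_distrib_left output_prob_def)
  also have "(\<Sum>x\<in>?E. (cmod (\<phi> x - \<psi> x))\<^sup>2) \<le> dist_sq B \<phi> \<psi>"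
    unfolding dist_sq_def using assms(1) by (intro sum_mono2) auto
  \<comment> \<open>The chain reads
    \<open>2/3 \<le> 3/2 * 1/3 + 3 * dist_sq B \<phi> \<psi>\<close>.\<close>
  finally show ?thesis using le by simp
qed

text \<open>An adversary bound: the entries in which \<open>F p\<close> differs from \<open>F (\<tau> s p)\<close> are disjoint for
  different \<open>s\<close>, so one query has total weight at most 1 to spend on separating \<open>F p\<close> from all
  of its \<open>card S\<close> neighbours.\<close>

lemma quantum_learns_card_le:
  fixes S :: "'s set" and I :: "'p set" and F :: "'p \<Rightarrow> bool mat"
  assumes "quantum_learns n (F ` I) T" "n > 0" "finite I" "I \<noteq> {}" "finite S"
    and closed: "\<And>s p. s \<in> S \<Longrightarrow> p \<in> I \<Longrightarrow> \<tau> s p \<in> I"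
    and invol: "\<And>s p. s \<in> S \<Longrightarrow> p \<in> I \<Longrightarrow> \<tau> s (\<tau> s p) = p"
    and neq: "\<And>s p. s \<in> S \<Longrightarrow> p \<in> I \<Longrightarrow> F (\<tau> s p) \<noteq> F p"
    and disj: "\<And>s s' p i j. \<lbrakk>s \<in> S; s' \<in> S; s \<noteq> s'; p \<in> I; i < n; j < n;
      F p $$ (i, j) \<noteq> F (\<tau> s p) $$ (i, j)\<rbrakk> \<Longrightarrow> F p $$ (i, j) = F (\<tau> s' p) $$ (i, j)"
  shows "real (card S) \<le> 72 * real T"
proof -
  obtain w U out where alg: "w > 0" "\<forall>t\<le>T. unitary_op (labels n w) (U t)"
    "\<forall>M\<in>F ` I. output_prob (labels n w) out (run_quantum (labels n w) U M T) M \<ge> 2 / 3"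
    using assms(1) unfolding quantum_learns_def by blast
  define B where "B = labels n w"
  have finB: "finite B" by (simp add: B_def)
  define \<psi> where "\<psi> t p = run_quantum B U (F p) t" for t p
  define P where "P s p = {x. F p $$ x \<noteq> F (\<tau> s p) $$ x}" for s p
  \<comment> \<open>The progress measure. It is 0 before any query, as the initial state ignores the
    input, grows by at most \<open>4 * card I\<close> per query, and must end at
    \<open>card S * card I / 18\<close> or more; hence \<open>72 = 4 * 18\<close>.\<close>
  define W where "W t = (\<Sum>s\<in>S. \<Sum>p\<in>I. dist_sq B (\<psi> t p) (\<psi> t (\<tau> s p)))" for t
  have norm: "(\<Sum>x\<in>B. (cmod (\<psi> t p x))\<^sup>2) = 1" if "t \<le> T" for t p
    unfolding B_def \<psi>_def using that alg by (intro norm_run_quantum[OF assms(2)]) auto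
  have mass: "(\<Sum>s\<in>S. query_mass n w (P s p) (\<psi> t p)) \<le> 1" if "p \<in> I" "t \<le> T" for p t
  proof -
    have "(\<Sum>s\<in>S. query_mass n w (P s p) (\<psi> t p)) =
      (\<Sum>x\<in>(\<Union>s\<in>S. {x. x \<in> B \<and> label_pos x \<in> P s p}). (cmod (\<psi> t p x))\<^sup>2)"
      unfolding query_mass_def B_def
    proof (rule sum.UNION_disjoint[symmetric, OF assms(5)])
      show "\<forall>s\<in>S. finite {x \<in> labels n w. label_pos x \<in> P s p}" by simp
      show "\<forall>s\<in>S. \<forall>s'\<in>S. s \<noteq> s' \<longrightarrow> {x \<in> labels n w. label_pos x \<in> P s p} \<inter>
        {x \<in> labels n w. label_pos x \<in> P s' p} = {}"
      proof (intro ballI impI equals0I)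
        fix s s' x assume s: "s \<in> S" "s' \<in> S" "s \<noteq> s'" and
          x: "x \<in> {x \<in> labels n w. label_pos x \<in> P s p} \<inter> {x \<in> labels n w. label_pos x \<in> P s' p}"
        then have "fst x < n" "fst (snd x) < n" by (auto simp: labels_def)
        from disj[OF s that(1) this] x show False by (auto simp: P_def)
      qed
    qed
    also have "\<dots> \<le> (\<Sum>x\<in>B. (cmod (\<psi> t p x))\<^sup>2)" using finB by (intro sum_mono2) auto
    finally show ?thesis using norm that by simp
  qed
  have mass_sum: "(\<Sum>s\<in>S. \<Sum>p\<in>I. query_mass n w (P s p) (\<psi> t p)) \<le> card I" if "t \<le> T" for t
  proof -
    have "(\<Sum>s\<in>S. \<Sum>p\<in>I. query_mass n w (P s p) (\<psi> t p))
      = (\<Sum>p\<in>I. \<Sum>s\<in>S. query_mass n w (P s p) (\<psi> t p))" by (rule sum.swap)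
    also have "\<dots> \<le> (\<Sum>p\<in>I. 1)" using mass that by (intro sum_mono) auto
    finally show ?thesis by simp
  qed
  \<comment> \<open>The mass of the neighbour's state is not bounded for a fixed \<open>p\<close>,
    but reindexing the sum over all of \<open>I\<close> by the involution \<open>\<tau> s\<close>,
    which keeps \<open>P s\<close>, reduces it to the previous bound.\<close>
  have mass_sum': "(\<Sum>s\<in>S. \<Sum>p\<in>I. query_mass n w (P s p) (\<psi> t (\<tau> s p))) \<le> card I" if "t \<le> T" for t
  proof -
    have "(\<Sum>p\<in>I. query_mass n w (P s p) (\<psi> t (\<tau> s p))) = (\<Sum>p\<in>I. query_mass n w (P s p) (\<psi> t p))"
      if s: "s \<in> S" for s
    proof (rule sum.reindex_bij_witness[of _ "\<tau> s" "\<tau> s"])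
      fix p assume p: "p \<in> I"
      have "P s (\<tau> s p) = P s p" using invol[OF s p] by (auto simp: P_def)
      then show "query_mass n w (P s (\<tau> s p)) (\<psi> t (\<tau> s p)) = query_mass n w (P s p) (\<psi> t (\<tau> s p))"
        by simp
    qed (use s closed invol in auto)
    then show ?thesis using mass_sum[OF that] by simp
  qed
  have "W t \<le> 4 * real t * real (card I)" if "t \<le> T" for t
    using that
  proof (induction t)
    case 0
    have "\<psi> 0 p = \<psi> 0 p'" for p p' by (simp add: \<psi>_def)
    then have "dist_sq B (\<psi> 0 p) (\<psi> 0 p') = 0" for p p'
      unfolding dist_sq_def
      by (metis (no_types, lifting) diff_self norm_zero sum.neutral zero_power2)
    then show ?case by (simp add: W_def)
  next
    case (Suc t)
    have "W (Suc t) \<le> (\<Sum>s\<in>S. \<Sum>p\<in>I. dist_sq B (\<psi> t p) (\<psi> t (\<tau> s p)) +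
      2 * (query_mass n w (P s p) (\<psi> t p) + query_mass n w (P s p) (\<psi> t (\<tau> s p))))"
      unfolding W_def
    proof (intro sum_mono)
      fix s p
      have "unitary_op B (U (Suc t))" using alg Suc.prems by (simp add: B_def)
      then show "dist_sq B (\<psi> (Suc t) p) (\<psi> (Suc t) (\<tau> s p)) \<le> dist_sq B (\<psi> t p) (\<psi> t (\<tau> s p)) +
        2 * (query_mass n w (P s p) (\<psi> t p) + query_mass n w (P s p) (\<psi> t (\<tau> s p)))"
        using dist_sq_oracle_le[of n w "F p" "\<psi> t p" "F (\<tau> s p)" "\<psi> t (\<tau> s p)"] finB
        by (simp add: \<psi>_def dist_sq_unitary P_def B_def)
    qed
    also have "\<dots> = W t + 2 * ((\<Sum>s\<in>S. \<Sum>p\<in>I. query_mass n w (P s p) (\<psi> t p)) +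
      (\<Sum>s\<in>S. \<Sum>p\<in>I. query_mass n w (P s p) (\<psi> t (\<tau> s p))))"
      by (simp add: W_def sum.distrib sum_distrib_left)
    also have "\<dots> \<le> 4 * real t * card I + 2 * (real (card I) + real (card I))"
      using Suc mass_sum[of t] mass_sum'[of t] by (intro add_mono mult_left_mono) auto
    finally show ?case by (simp add: algebra_simps)
  qed
  then have "W T \<le> 4 * real T * real (card I)" by simp
  moreover have "(\<Sum>s\<in>S. \<Sum>p\<in>I. 1 / 18) \<le> W T"
    unfolding W_def
  proof (intro sum_mono)
    fix s p assume s: "s \<in> S" and p: "p \<in> I"
    show "1 / 18 \<le> dist_sq B (\<psi> T p) (\<psi> T (\<tau> s p))"
      using neq[OF s p] closed[OF s p] alg(3) p norm[of T "\<tau> s p"]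
      by (intro dist_sq_ge_of_output_prob[OF finB, where out = out and A = "F p" and A' = "F (\<tau> s p)"])
        (auto simp: \<psi>_def B_def)
  qed
  ultimately have "real (card S) * real (card I) \<le> (72 * real T) * real (card I)" by simp
  moreover have "real (card I) > 0" using assms(3,4) by (simp add: card_gt_0_iff)
  ultimately show ?thesis by (rule mult_right_le_imp_le)
qed

lemma quantum_learns_half_graphs_lower:
  assumes "quantum_learns n (col_permuted_half_graphs n) T" "n > 0"
  shows "real n - 1 \<le> 72 * real T"
proof -
  let ?I = "{\<pi>. \<pi> permutes {..<n}}"
  let ?\<tau> = "\<lambda>s \<pi>. Transposition.transpose s (Suc s) \<circ> \<pi>"
  have swap: "?\<tau> s \<pi> permutes {..<n}" if "s < n - 1" "\<pi> permutes {..<n}" for s \<pi>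
    using that by (intro permutes_compose permutes_swap_id) auto
  \<comment> \<open>Exchanging the values \<open>s\<close> and \<open>s + 1\<close> affects the
    comparison \<open>\<pi> j \<le> i\<close> only at \<open>i = s\<close>, so different
    \<open>s\<close> touch different rows.\<close>
  have only_row: "perm_half_graph n \<pi> $$ (i, j) = perm_half_graph n (?\<tau> s \<pi>) $$ (i, j)"
    if "s < n - 1" "\<pi> permutes {..<n}" "i < n" "j < n" "i \<noteq> s" for s \<pi> i j
    using that perm_half_graph_index[OF that(2-4)] perm_half_graph_index[OF swap[OF that(1,2)] that(3,4)]
    by (auto simp: Transposition.transpose_def)
  have "real (card {..<n - 1}) \<le> 72 * real T"
  proof (rule quantum_learns_card_le[where F = "perm_half_graph n" and I = ?I and \<tau> = ?\<tau> and n = n])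
    show "quantum_learns n (perm_half_graph n ` ?I) T"
      using assms(1) by (simp add: col_permuted_half_graphs_eq)
    show "?I \<noteq> {}" using permutes_id by blast
    show "perm_half_graph n (?\<tau> s \<pi>) \<noteq> perm_half_graph n \<pi>" if s: "s \<in> {..<n - 1}" and p: "\<pi> \<in> ?I" for s \<pi>
    proof
      assume "perm_half_graph n (?\<tau> s \<pi>) = perm_half_graph n \<pi>"
      then have "?\<tau> s \<pi> = \<pi>"
        using inj_onD[OF inj_on_perm_half_graph] swap s p by simp
      \<comment> \<open>Evaluating at a preimage of \<open>s\<close> would make the transposition
        fix \<open>s\<close>.\<close>
      moreover have "surj \<pi>" using p permutes_surj by blast
      ultimately have "Transposition.transpose s (Suc s) s = s" by (metis comp_apply surjD)
      then show False by simp
    qed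
    show "perm_half_graph n \<pi> $$ (i, j) = perm_half_graph n (?\<tau> s' \<pi>) $$ (i, j)"
      if "s \<in> {..<n - 1}" "s' \<in> {..<n - 1}" "s \<noteq> s'" "\<pi> \<in> ?I" "i < n" "j < n"
        "perm_half_graph n \<pi> $$ (i, j) \<noteq> perm_half_graph n (?\<tau> s \<pi>) $$ (i, j)" for s s' \<pi> i j
      using only_row[of s \<pi> i j] only_row[of s' \<pi> i j] that by auto
  qed (use assms(2) swap in \<open>auto simp: finite_permutations simp flip: comp_assoc\<close>)
  then show ?thesis using assms(2) by simp
qed


section \<open>The bounds\<close>

lemma det_learns_half_graphs_log:
  assumes "n \<ge> 1"
  obtains T where "det_learns n (col_permuted_half_graphs n) T"
    "real T \<le> 2 * (real n * log 2 (real n))"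
proof -
  define k where "k = nat \<lceil>log 2 (real n)\<rceil>"
  have log0: "0 \<le> log 2 (real n)" using assms by simp
  have le: "log 2 (real n) \<le> real k" by (simp add: k_def real_nat_ceiling_ge)
  then have "real n \<le> 2 powr real k" using assms by (simp add: log_le_iff)
  then have "real n \<le> real (2 ^ k)" by (simp add: powr_realpow)
  then have "n \<le> 2 ^ k" by (simp only: of_nat_le_iff)
  then have det: "det_learns n (col_permuted_half_graphs n) (n * k)" by (rule det_learns_half_graphs)
  \<comment> \<open>Rounding up adds less than 1, which is at most \<open>log 2 n\<close> once
    \<open>n \<ge> 2\<close>; for \<open>n = 1\<close> both sides are 0.\<close>
  have "real k \<le> 2 * log 2 (real n)"
  proof (cases "n = 1")
    case False
    then have "1 \<le> log 2 (real n)" using assms by simp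
    moreover have "real k < log 2 (real n) + 1" unfolding k_def using log0 by linarith
    ultimately show ?thesis by linarith
  qed (simp add: k_def)
  then have "real n * real k \<le> real n * (2 * log 2 (real n))" by (rule mult_left_mono) simp
  then show ?thesis using that[OF det] by simp
qed

theorem theorem1p2:
  shows "\<exists>c C :: real. c > 0 \<and> C > 0 \<and> (\<forall>n\<ge>1.
      c * (real n * log 2 (real n)) \<le> real (D_query n (col_permuted_half_graphs n)) \<and>
      real (D_query n (col_permuted_half_graphs n)) \<le> C * (real n * log 2 (real n)) \<and>
      c * (real n * log 2 (real n)) \<le> real (R_query n (col_permuted_half_graphs n)) \<and>
      real (R_query n (col_permuted_half_graphs n)) \<le> C * (real n * log 2 (real n)) \<and>
      (n \<ge> 2 \<longrightarrow> c * real n \<le> real (Q_query n (col_permuted_half_graphs n))) \<and>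
      real (Q_query n (col_permuted_half_graphs n)) \<le> C * (real n * log 2 (real n)))"
\<comment> \<open>For \<open>n \<ge> 2\<close> we have \<open>n - 1 \<ge> n / 2\<close>, so the
  quantum constant is \<open>1 / (2 * 72)\<close>, which is below the classical \<open>1/8\<close>.
  At \<open>n = 1\<close> there is a single matrix and no query is made.\<close>
proof (rule exI[of _ "1 / 144"], rule exI[of _ 2], intro conjI allI impI)
  fix n :: nat assume n: "n \<ge> 1"
  let ?X = "col_permuted_half_graphs n" and ?L = "real n * log 2 (real n)"
  have L: "0 \<le> ?L" using n by simp
  obtain T where T: "det_learns n ?X T" "real T \<le> 2 * ?L"
    using det_learns_half_graphs_log[OF n] by blast
  note rand = det_learns_imp_rand_learns[OF T(1)]
  have quant: "quantum_learns n ?X T" using det_learns_imp_quantum_learns[OF T(1)] n by simp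
  have D: "det_learns n ?X (D_query n ?X)" unfolding D_query_def by (rule LeastI[of _ T]) (rule T)
  have R: "rand_learns n ?X (R_query n ?X)" unfolding R_query_def by (rule LeastI[of _ T]) (rule rand)
  have Q: "quantum_learns n ?X (Q_query n ?X)" unfolding Q_query_def by (rule LeastI[of _ T]) (rule quant)
  have "D_query n ?X \<le> T" unfolding D_query_def using T(1) by (rule Least_le)
  then show "real (D_query n ?X) \<le> 2 * ?L" using T(2) by linarith
  have "R_query n ?X \<le> T" unfolding R_query_def using rand by (rule Least_le)
  then show "real (R_query n ?X) \<le> 2 * ?L" using T(2) by linarith
  have "Q_query n ?X \<le> T" unfolding Q_query_def using quant by (rule Least_le)
  then show "real (Q_query n ?X) \<le> 2 * ?L" using T(2) by linarith
  show "1 / 144 * ?L \<le> real (D_query n ?X)"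
    using rand_learns_half_graphs_lower[OF det_learns_imp_rand_learns[OF D] n] L by linarith
  show "1 / 144 * ?L \<le> real (R_query n ?X)"
    using rand_learns_half_graphs_lower[OF R n] L by linarith
  show "1 / 144 * real n \<le> real (Q_query n ?X)" if "2 \<le> n"
    using quantum_learns_half_graphs_lower[OF Q] that by linarith
qed simp_all

end
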